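(* Let $G=\mathrm{SL}(2,\mathbb{R})\ltimes\mathbb{R}^2$ and let $N^+=\left\{\begin{pmatrix}1&x\\0&1\end{pmatrix}: x\in\mathbb{R}\right\}\subset\mathrm{SL}(2,\mathbb{R})\subset G$. Then the closure of $\{gN^+g^{-1}\mid g\in G\}$ in $\mathrm{Sub}_G$ (with the Chabauty topology) consists of the conjugates in $G$ of $N^+$ and of $V_0=\{(I,(t,0))\mid t\in\mathbb{R}\}$.
   Context: Elements of $G=\mathrm{SL}(2,\mathbb{R})\ltimes\mathbb{R}^2$ are written $(g,v)$ with $g\in\mathrm{SL}(2,\mathbb{R})$, $v\in\mathbb{R}^2$, with group operation $(g,v)(g',v')=(gg',v+g(v'))$. $\mathrm{SL}(2,\mathbb{R})$ and $\mathbb{R}^2$ are identified with closed subgroups of $G$ via $g\mapsto(g,(0,0))$ and $v\mapsto(I,v)$, where $I$ is the $2\times2$ identity matrix. $\mathrm{Sub}_G$ is the space of closed subgroups of $G$ with the Chabauty topology, generated by the sets $\{H\in\mathrm{Sub}_G\mid H\cap C=\emptyset\}$ for $C\subset G$ compact and $\{H\in\mathrm{Sub}_G\mid H\cap U\neq\emptyset\}$ for $U\subset G$ open; it is compact and metrizable. Equivalently, $H_n\to H$ iff every $h\in H$ is a limit of some sequence $h_n\in H_n$, and whenever $x_{k_n}\in H_{k_n}$ with $k_{n+1}>k_n$ and $x_{k_n}\to x$, one has $x\in H$. *)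

theory Defs
  imports "HOL-Analysis.Analysis" "HOL-Algebra.Coset"
begin

definition SL2_R2 :: "((real^2^2) \<times> (real^2)) monoid" where
  "SL2_R2 = \<lparr> carrier = {g. det g = 1} \<times> UNIV,
              monoid.mult = (\<lambda>(g, v) (g', v'). (g ** g', v + g *v v')),
              one = (mat 1, 0) \<rparr>"

definition SL2_R2_top :: "((real^2^2) \<times> (real^2)) topology" where
  "SL2_R2_top = top_of_set (carrier SL2_R2)"

definition closed_subgroups :: "('a, 'b) monoid_scheme \<Rightarrow> 'a topology \<Rightarrow> 'a set set" where
  "closed_subgroups G T = {H. subgroup H G \<and> closedin T H}"

definition chabauty_topology :: "('a, 'b) monoid_scheme \<Rightarrow> 'a topology \<Rightarrow> 'a set topology" where
  "chabauty_topology G T = topology_generated_by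
     ({{H \<in> closed_subgroups G T. H \<inter> C = {}} | C. compactin T C} \<union>
      {{H \<in> closed_subgroups G T. H \<inter> U \<noteq> {}} | U. openin T U})"

definition conjugate_of :: "('a, 'b) monoid_scheme \<Rightarrow> 'a \<Rightarrow> 'a set \<Rightarrow> 'a set" where
  "conjugate_of G g H = (g <#\<^bsub>G\<^esub> H) #>\<^bsub>G\<^esub> (inv\<^bsub>G\<^esub> g)"

(* Subgroups of SL(2,R) and of R^2 are regarded as subgroups of the semidirect
   product via g |-> (g, 0) and v |-> (I, v).  Nested vector [...] lists rows. *)
definition N_plus :: "((real^2^2) \<times> (real^2)) set" where
  "N_plus = {(vector [vector [1, x], vector [0, 1]], 0) | x. True}"

definition V_0 :: "((real^2^2) \<times> (real^2)) set" where
  "V_0 = {(mat 1, vector [t, 0]) | t. True}"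

lemma topspace_chabauty_topology: "topspace (chabauty_topology G T) = closed_subgroups G T"
proof -
  have "{H \<in> closed_subgroups G T. H \<inter> {} = {}} \<in> {{H \<in> closed_subgroups G T. H \<inter> C = {}} | C. compactin T C}"
    by (rule CollectI) (intro exI[of _ "{}"] conjI refl, simp)
  then show ?thesis
    unfolding chabauty_topology_def topology_generated_by_topspace by fastforce
qed

lemma group_SL2_R2: "group SL2_R2"
proof (rule groupI)
  fix p assume "p \<in> carrier SL2_R2"
  then obtain g v where p: "p = (g, v)" and d: "det g = 1"
    by (auto simp: SL2_R2_def)
  then have "invertible g" by (simp add: invertible_det_nz)
  then obtain h where hg: "h ** g = mat 1" by (auto simp: invertible_def)
  then have "det h * det g = 1" by (metis det_mul det_I)
  then have "det h = 1" using d by simp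
  moreover have "(h, - (h *v v)) \<otimes>\<^bsub>SL2_R2\<^esub> p = \<one>\<^bsub>SL2_R2\<^esub>"
    by (simp add: SL2_R2_def p hg)
  ultimately show "\<exists>q\<in>carrier SL2_R2. q \<otimes>\<^bsub>SL2_R2\<^esub> p = \<one>\<^bsub>SL2_R2\<^esub>"
    by (intro bexI[of _ "(h, - (h *v v))"]) (auto simp: SL2_R2_def)
qed (auto simp: SL2_R2_def det_mul matrix_mul_assoc matrix_vector_mul_assoc
       matrix_vector_right_distrib add.assoc)

end

(* The conjugates of N^+ and of V_0 are exactly the groups {(I + s a X, s b u) | s real}, where u is
   a unit vector, a^2 + b^2 = 1 and X is the nilpotent matrix x |-> det(u, x) u; those with
   a \<noteq> 0 are conjugate to N^+, those with a = 0 to V_0.  Each of them is an affine line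
   through the identity in the ambient vector space, and it depends continuously on its direction in the
   Chabauty topology because points far out on the line leave every compact set.  So the whole family
   is a continuous image of a torus, hence compact, hence closed, as the Chabauty topology is
   Hausdorff; and the condition a \<noteq> 0 is dense in the torus. *)
theory Submission
  imports Defs
begin

section \<open>Chabauty topology of a general group\<close>

lemma Hausdorff_space_chabauty:
  assumes "locally_compact_space T" "Hausdorff_space T"
  shows "Hausdorff_space (chabauty_topology G T)"
proof -
  have sep: "\<exists>U V. openin (chabauty_topology G T) U \<and> openin (chabauty_topology G T) V \<and>
               H \<in> U \<and> K \<in> V \<and> disjnt U V"
    if HK: "H \<in> closed_subgroups G T" "K \<in> closed_subgroups G T" and h: "h \<in> H" "h \<notin> K"
    for H K h
  proof -
    have "closedin T H" "closedin T K" using HK by (auto simp: closed_subgroups_def)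
    then have "openin T (topspace T - K)" "h \<in> topspace T - K"
      using h closedin_subset by blast+
    moreover have "neighbourhood_base_of (compactin T) T"
      using assms locally_compact_space_neighbourhood_base by blast
    \<comment> \<open>A compact neighbourhood \<open>C\<close> of \<open>h\<close> avoiding
      \<open>K\<close> separates the two: \<open>H\<close> meets the open \<open>U\<close> inside
      \<open>C\<close>, while \<open>K\<close> misses \<open>C\<close>.\<close>
    ultimately obtain U C where U: "openin T U" "compactin T C" "h \<in> U" "U \<subseteq> C" "C \<subseteq> topspace T - K"
      unfolding neighbourhood_base_of by meson
    let ?U = "{H \<in> closed_subgroups G T. H \<inter> U \<noteq> {}}"
    let ?V = "{H \<in> closed_subgroups G T. H \<inter> C = {}}"
    have "openin (chabauty_topology G T) ?U" "openin (chabauty_topology G T) ?V"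
      unfolding chabauty_topology_def using U(1,2) by (auto intro!: topology_generated_by_Basis)
    moreover have "H \<in> ?U" "K \<in> ?V" "disjnt ?U ?V"
      using HK h U by (auto simp: disjnt_def)
    ultimately show ?thesis by blast
  qed
  show ?thesis
    unfolding Hausdorff_space_def topspace_chabauty_topology
  proof clarify
    fix H K assume HK: "H \<in> closed_subgroups G T" "K \<in> closed_subgroups G T" and "H \<noteq> K"
    then consider h where "h \<in> H" "h \<notin> K" | h where "h \<in> K" "h \<notin> H" by blast
    then show "\<exists>U V. openin (chabauty_topology G T) U \<and> openin (chabauty_topology G T) V \<and>
               H \<in> U \<and> K \<in> V \<and> disjnt U V"
      by cases (use sep HK disjnt_sym in meson)+
  qed
qed

text \<open>It suffices to pull back the two kinds of subbasic sets. Hitting an open set is open for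
  each fixed \<open>s\<close>. Hitting a compact set is closed because the unit norm of
  \<open>d p\<close> confines \<open>s\<close> to a compact interval, along which projection is
  closed.\<close>

lemma continuous_map_chabauty_affine_line:
  fixes d :: "'p::euclidean_space \<Rightarrow> 'a::euclidean_space"
  assumes d: "continuous_on UNIV d" "\<And>p. norm (d p) = 1"
    and sub: "\<And>p. range (\<lambda>s. x0 + s *\<^sub>R d p) \<in> closed_subgroups G (top_of_set S)"
  shows "continuous_map euclidean (chabauty_topology G (top_of_set S))
           (\<lambda>p. range (\<lambda>s. x0 + s *\<^sub>R d p))"
  unfolding chabauty_topology_def
proof (rule continuous_on_generated_topo)
  let ?L = "\<lambda>p. range (\<lambda>s. x0 + s *\<^sub>R d p)"
  have inS: "x0 + s *\<^sub>R d p \<in> S" for s p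
    using sub[of p] closedin_subset[of "top_of_set S"] by (fastforce simp: closed_subgroups_def)
  have cont: "continuous_on UNIV (\<lambda>(s, p). x0 + s *\<^sub>R d p)"
    unfolding split_def
    by (intro continuous_intros continuous_on_compose2[OF d(1)]) auto
  have hit: "open {p. ?L p \<inter> U \<noteq> {}}" if U: "openin (top_of_set S) U" for U
  proof -
    obtain W where W: "open W" "U = S \<inter> W" using U by (auto simp: openin_open)
    have "{p. ?L p \<inter> U \<noteq> {}} = (\<Union>s. (\<lambda>p. x0 + s *\<^sub>R d p) -` W)"
      using inS by (auto simp: W(2))
    moreover have "open ((\<lambda>p. x0 + s *\<^sub>R d p) -` W)" for s
      by (intro open_vimage W(1) continuous_intros d(1))
    ultimately show ?thesis by auto
  qed
  have miss: "open {p. ?L p \<inter> C = {}}" if "compactin (top_of_set S) C" for C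
  proof -
    have C: "compact C" using that by (simp add: compactin_subtopology)
    then obtain M where M: "\<And>x. x \<in> C \<Longrightarrow> norm (x - x0) \<le> M"
      using compact_imp_bounded[OF C] unfolding bounded_any_center[where a=x0]
      by (auto simp: dist_norm norm_minus_commute)
    \<comment> \<open>The point with parameter \<open>s\<close> has distance |s| from
      \<open>x0\<close>, so restricting to this interval loses no intersection with
      \<open>C\<close>.\<close>
    let ?Z = "{p. \<exists>s. s \<in> {-M..M} \<and> (s, p) \<in> (\<lambda>(s, p). x0 + s *\<^sub>R d p) -` C}"
    have bound: "s \<in> {-M..M}" if "x0 + s *\<^sub>R d p \<in> C" for s p
      using M[OF that] d(2) by (auto simp: abs_le_iff)
    have "closed ?Z"
      by (intro closed_compact_projection compact_Icc closed_vimage compact_imp_closed C cont)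
    moreover have "{p. ?L p \<inter> C = {}} = - ?Z"
    proof (rule Set.set_eqI)
      fix p
      have "?L p \<inter> C = {} \<longleftrightarrow> (\<forall>s. x0 + s *\<^sub>R d p \<notin> C)" by auto
      then show "p \<in> {p. ?L p \<inter> C = {}} \<longleftrightarrow> p \<in> - ?Z" using bound[of _ p] by auto
    qed
    ultimately show ?thesis by (simp only: open_Compl)
  qed
  show "openin euclidean (?L -` W \<inter> topspace euclidean)"
    if "W \<in> {{H \<in> closed_subgroups G (top_of_set S). H \<inter> C = {}} | C. compactin (top_of_set S) C} \<union>
      {{H \<in> closed_subgroups G (top_of_set S). H \<inter> U \<noteq> {}} | U. openin (top_of_set S) U}" for W
    using that hit miss sub by (auto simp: vimage_def)
  \<comment> \<open>Missing the empty set is no condition, so all closed subgroups together form one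
    subbasic set.\<close>
  have "compactin (top_of_set S) {}" by simp
  then show "?L ` topspace euclidean \<subseteq>
    \<Union>({{H \<in> closed_subgroups G (top_of_set S). H \<inter> C = {}} | C. compactin (top_of_set S) C} \<union>
      {{H \<in> closed_subgroups G (top_of_set S). H \<inter> U \<noteq> {}} | U. openin (top_of_set S) U})"
    using sub by blast
qed

text \<open>Stating conjugation by \<open>g\<close> as an intertwining relation avoids computing
  inverses in concrete groups.\<close>

lemma (in group) conjugate_of_eq_image:
  assumes "g \<in> carrier G" "H \<subseteq> carrier G" "\<And>h. h \<in> H \<Longrightarrow> f h \<in> carrier G"
    and "\<And>h. h \<in> H \<Longrightarrow> g \<otimes> h = f h \<otimes> g"
  shows "conjugate_of G g H = f ` H"
proof -
  have "g \<otimes> h \<otimes> inv g = f h" if "h \<in> H" for h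
    using that assms by (subst inv_solve_right') auto
  then show ?thesis
    unfolding conjugate_of_def l_coset_def r_coset_def by (auto simp: image_iff)
qed

section \<open>Conjugates of \<open>N_plus\<close> and \<open>V_0\<close> as affine lines\<close>

lemma mult_SL2_R2: "(g, v) \<otimes>\<^bsub>SL2_R2\<^esub> (g', v') = (g ** g', v + g *v v')"
  by (simp add: SL2_R2_def)

lemma carrier_SL2_R2: "(g, v) \<in> carrier SL2_R2 \<longleftrightarrow> det g = 1"
  by (simp add: SL2_R2_def)

lemmas matrix_2_simps = vec_eq_iff forall_2 matrix_matrix_mult_def matrix_vector_mult_def
  sum_2 mat_def column_def det_2

text \<open>The base point is the group identity, but the sum is taken in the ambient vector
  space.\<close>

definition line :: "(real^2^2) \<times> (real^2) \<Rightarrow> ((real^2^2) \<times> (real^2)) set" where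
  "line d = range (\<lambda>s. (mat 1, 0) + s *\<^sub>R d)"

lemma line_scaleR:
  assumes "k \<noteq> 0"
  shows "line (k *\<^sub>R d) = line d"
proof -
  have "range (\<lambda>s. s * k) = UNIV"
    using assms by (intro surjI[where f="\<lambda>s. s / k"]) auto
  then have "line d = (\<lambda>s. (mat 1, 0) + s *\<^sub>R d) ` range (\<lambda>s. s * k)" by (simp add: line_def)
  then show ?thesis by (simp add: line_def image_image)
qed

(* The matrix of x |-> det(w, x) w. *)
definition nilp :: "real^2 \<Rightarrow> real^2^2" where
  "nilp w = vector [vector [- w$1 * w$2, w$1 * w$1], vector [- w$2 * w$2, w$1 * w$2]]"

lemma nilp_scaleR: "nilp (r *\<^sub>R w) = (r * r) *\<^sub>R nilp w"
  by (simp add: nilp_def vec_eq_iff forall_2)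

lemma matrix_mult_add_rdistrib: "(A + B) ** C = A ** C + B ** C"
  for A B :: "'a::semiring_1^'n^'m"
  by (simp add: matrix_matrix_mult_def vec_eq_iff distrib_right sum.distrib)

lemma nilp_vector: "nilp w *v v = (w$1 * v$2 - w$2 * v$1) *\<^sub>R w"
  by (simp add: nilp_def matrix_2_simps algebra_simps)

text \<open>With w the first column, a column x of \<open>A\<close> goes to det(w, x) w, which is 0
  for the first column and \<open>det A\<close> times w for the second.\<close>

lemma nilp_column_mult:
  "nilp (column 1 A) ** A = det A *\<^sub>R vector [vector [0, A$1$1], vector [0, A$2$1]]"
  by (simp add: nilp_def matrix_2_simps algebra_simps)

text \<open>\<open>nilp w\<close> has trace and determinant 0, so I plus any multiple of it has
  determinant 1.\<close>

lemma line_in_carrier: "(mat 1, 0) + s *\<^sub>R (a *\<^sub>R nilp w, y) \<in> carrier SL2_R2"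
  by (simp add: carrier_SL2_R2 nilp_def det_2 mat_def algebra_simps)

text \<open>\<open>nilp w\<close> squares to zero and kills \<open>w\<close>, so all cross terms
  vanish.\<close>

lemma line_mult:
  "((mat 1, 0) + s *\<^sub>R (a *\<^sub>R nilp w, b *\<^sub>R w)) \<otimes>\<^bsub>SL2_R2\<^esub> ((mat 1, 0) + t *\<^sub>R (a *\<^sub>R nilp w, b *\<^sub>R w))
    = (mat 1, 0) + (s + t) *\<^sub>R (a *\<^sub>R nilp w, b *\<^sub>R w)"
  by (simp add: mult_SL2_R2 nilp_def matrix_2_simps algebra_simps)

lemma line_closed_subgroup:
  "line (a *\<^sub>R nilp w, b *\<^sub>R w) \<in> closed_subgroups SL2_R2 SL2_R2_top"
proof -
  interpret group SL2_R2 by (rule group_SL2_R2)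
  define e where "e = (\<lambda>s. (mat 1, 0) + s *\<^sub>R (a *\<^sub>R nilp w, b *\<^sub>R w))"
  have e_carrier: "e s \<in> carrier SL2_R2" for s
    unfolding e_def by (rule line_in_carrier)
  have e_mult: "e s \<otimes>\<^bsub>SL2_R2\<^esub> e t = e (s + t)" for s t
    unfolding e_def by (rule line_mult)
  have "e 0 = \<one>\<^bsub>SL2_R2\<^esub>" by (simp add: e_def SL2_R2_def)
  then have e_inv: "inv\<^bsub>SL2_R2\<^esub> (e s) = e (- s)" for s
    by (intro inv_equality) (simp_all add: e_mult e_carrier)
  have "subgroup (range e) SL2_R2"
    by (rule subgroupI) (auto simp: e_carrier e_mult e_inv)
  moreover have "closed (range e)"
  proof -
    have "range e = (+) (mat 1, 0) ` span {(a *\<^sub>R nilp w, b *\<^sub>R w)}"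
      unfolding e_def span_singleton image_image ..
    then show ?thesis by (simp add: closed_translation closed_span)
  qed
  moreover have "line (a *\<^sub>R nilp w, b *\<^sub>R w) = range e" by (simp add: line_def e_def)
  ultimately show ?thesis
    by (auto simp: closed_subgroups_def SL2_R2_top_def subgroup_def intro!: closed_subset)
qed

text \<open>With w the first column of \<open>A\<close> and X = \<open>nilp w\<close>, the element
  with parameter x becomes I + x X in the matrix part. The vector part is v - (I + x X) v = -x
  det(w, v) w.\<close>

lemma conjugate_N_plus:
  assumes "det A = 1"
  shows "conjugate_of SL2_R2 (A, v) N_plus =
         line (nilp (column 1 A), (- (A$1$1 * v$2 - A$2$1 * v$1)) *\<^sub>R column 1 A)"
proof -
  interpret group SL2_R2 by (rule group_SL2_R2)
  let ?d = "(nilp (column 1 A), (- (A$1$1 * v$2 - A$2$1 * v$1)) *\<^sub>R column 1 A)"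
  \<comment> \<open>The upper right entry recovers the parameter of an element of
    \<open>N_plus\<close>.\<close>
  let ?f = "\<lambda>h :: (real^2^2) \<times> (real^2). (mat 1, 0) + (fst h $ 1 $ 2) *\<^sub>R ?d"
  have N: "N_plus = range (\<lambda>x. (vector [vector [1, x], vector [0, 1]], 0))"
    by (auto simp: N_plus_def)
  have "(A, v) \<otimes>\<^bsub>SL2_R2\<^esub> h = ?f h \<otimes>\<^bsub>SL2_R2\<^esub> (A, v)" if hN: "h \<in> N_plus" for h
  proof -
    obtain x where h: "h = (vector [vector [1, x], vector [0, 1]], 0)" using hN by (auto simp: N)
    have A_mult: "A ** vector [vector [1, x], vector [0, 1]] = A + x *\<^sub>R (nilp (column 1 A) ** A)"
      unfolding nilp_column_mult assms by (simp add: matrix_2_simps)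
    show ?thesis
      unfolding h mult_SL2_R2
      by (simp add: A_mult mult_SL2_R2 matrix_mult_add_rdistrib matrix_vector_mult_add_rdistrib
          scaleR_matrix_vector_assoc[symmetric] scalar_matrix_assoc[symmetric] nilp_vector)
        (simp add: column_def vec_eq_iff algebra_simps)
  qed
  moreover have "N_plus \<subseteq> carrier SL2_R2" by (auto simp: N carrier_SL2_R2 det_2)
  moreover have "?f h \<in> carrier SL2_R2" for h
    using line_in_carrier[of _ 1] unfolding scaleR_one .
  ultimately have "conjugate_of SL2_R2 (A, v) N_plus = ?f ` N_plus"
    by (intro conjugate_of_eq_image) (use assms in \<open>auto simp: carrier_SL2_R2\<close>)
  then show ?thesis by (simp add: N line_def image_image)
qed

lemma conjugate_V_0:
  assumes "det A = 1"
  shows "conjugate_of SL2_R2 (A, v) V_0 = line (0, column 1 A)"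
proof -
  interpret group SL2_R2 by (rule group_SL2_R2)
  let ?f = "\<lambda>h :: (real^2^2) \<times> (real^2). (mat 1, 0) + (snd h $ 1) *\<^sub>R (0, column 1 A)"
  have V: "V_0 = range (\<lambda>t. (mat 1, vector [t, 0]))"
    by (auto simp: V_0_def)
  have "(A, v) \<otimes>\<^bsub>SL2_R2\<^esub> h = ?f h \<otimes>\<^bsub>SL2_R2\<^esub> (A, v)" if "h \<in> V_0" for h
    using that by (auto simp: V mult_SL2_R2 matrix_2_simps)
  moreover have "V_0 \<subseteq> carrier SL2_R2" by (auto simp: V carrier_SL2_R2)
  moreover have "?f h \<in> carrier SL2_R2" for h by (simp add: carrier_SL2_R2)
  ultimately have "conjugate_of SL2_R2 (A, v) V_0 = ?f ` V_0"
    by (intro conjugate_of_eq_image) (use assms in \<open>auto simp: carrier_SL2_R2\<close>)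
  then show ?thesis by (simp add: V line_def image_image)
qed

section \<open>Parametrization of the lines by two angles\<close>

definition circ :: "real \<Rightarrow> real^2" where
  "circ \<alpha> = vector [cos \<alpha>, sin \<alpha>]"

text \<open>The first angle is that of the unit vector u, the second that of the coefficient pair
  (a, b).\<close>

definition direction :: "real \<times> real \<Rightarrow> (real^2^2) \<times> (real^2)" where
  "direction p = (cos (snd p) *\<^sub>R nilp (circ (fst p)), sin (snd p) *\<^sub>R circ (fst p))"

lemma norm_direction: "norm (direction p) = 1"
proof -
  have "norm (circ \<alpha>) = 1" for \<alpha>
    by (simp add: circ_def norm_vec_def L2_set_def sum_2)
  moreover have "norm (nilp (circ \<alpha>)) = 1" for \<alpha>
  proof -
    \<comment> \<open>The squared entries are c^4, s^4 and twice c^2 s^2. The Pythagorean rules are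
      switched off so that both sides expand to the same polynomial.\<close>
    have "norm (nilp (circ \<alpha>)) = sqrt (((sin \<alpha>)\<^sup>2 + (cos \<alpha>)\<^sup>2)\<^sup>2)"
      unfolding power2_eq_square
      by (simp add: nilp_def circ_def norm_vec_def L2_set_def sum_2 power2_eq_square algebra_simps
          del: sin_cos_squared_add sin_cos_squared_add2 sin_cos_squared_add3)
    then show ?thesis by simp
  qed
  ultimately show ?thesis by (simp add: direction_def norm_Pair)
qed

lemma continuous_on_vector_2:
  fixes f g :: "'a::topological_space \<Rightarrow> 'b::{topological_space, zero}"
  assumes "continuous_on S f" "continuous_on S g"
  shows "continuous_on S (\<lambda>x. vector [f x, g x] :: 'b^2)"
proof -
  have "(\<lambda>x. vector [f x, g x] :: 'b^2) = (\<lambda>x. \<chi> i. if i = 1 then f x else g x)"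
    by (auto simp: vec_eq_iff forall_2)
  moreover have "continuous_on S (\<lambda>x. if i = 1 then f x else g x)" for i :: 2
    using assms by (cases "i = 1") simp_all
  ultimately show ?thesis by (simp only:) (intro continuous_on_vec_lambda)
qed

lemma continuous_direction: "continuous_on UNIV direction"
  unfolding direction_def nilp_def circ_def vector_2
  by (intro continuous_intros continuous_on_vector_2)

lemma polar:
  fixes w :: "real^2"
  assumes "w \<noteq> 0"
  obtains r \<alpha> where "r \<noteq> 0" "w = r *\<^sub>R circ \<alpha>"
proof -
  obtain r \<alpha> where "w$1 = r * cos \<alpha>" "w$2 = r * sin \<alpha>" using polar_Ex by blast
  then have "w = r *\<^sub>R circ \<alpha>" by (simp add: circ_def vec_eq_iff forall_2)
  with assms that show thesis by auto
qed

lemma conjugates_N_plus: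
  "{conjugate_of SL2_R2 g N_plus | g. g \<in> carrier SL2_R2} =
   (\<lambda>p. line (direction p)) ` {p. cos (snd p) \<noteq> 0}"
proof (intro equalityI subsetI)
  fix H assume "H \<in> {conjugate_of SL2_R2 g N_plus | g. g \<in> carrier SL2_R2}"
  then obtain A v where A: "det A = 1" and H: "H = conjugate_of SL2_R2 (A, v) N_plus"
    by (auto simp: carrier_SL2_R2)
  define k where "k = - (A$1$1 * v$2 - A$2$1 * v$1)"
  have "column 1 A \<noteq> 0" using A by (auto simp: matrix_2_simps)
  then obtain r \<alpha> where r: "r \<noteq> 0" "column 1 A = r *\<^sub>R circ \<alpha>" by (rule polar)
  \<comment> \<open>A second use of polar coordinates: (r^2 X, k r u) is r times (r X, k u), and (r,
    k) is q times a unit vector whose cosine is nonzero because r is.\<close>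
  obtain q \<theta> where q: "r = q * cos \<theta>" "k = q * sin \<theta>" using polar_Ex by blast
  have "(nilp (column 1 A), k *\<^sub>R column 1 A) = (r * q) *\<^sub>R direction (\<alpha>, \<theta>)"
    unfolding r(2) nilp_scaleR direction_def by (simp add: q mult.commute mult.left_commute)
  then have "H = line (direction (\<alpha>, \<theta>))"
    using r(1) q by (simp only: H conjugate_N_plus[OF A] k_def[symmetric]) (simp add: line_scaleR)
  then show "H \<in> (\<lambda>p. line (direction p)) ` {p. cos (snd p) \<noteq> 0}"
    using r q by auto
next
  fix H assume "H \<in> (\<lambda>p. line (direction p)) ` {p. cos (snd p) \<noteq> 0}"
  then obtain \<alpha> \<theta> where H: "H = line (direction (\<alpha>, \<theta>))" and \<theta>: "cos \<theta> \<noteq> 0" by auto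
  define A :: "real^2^2" where "A = vector [vector [cos \<alpha>, - sin \<alpha>], vector [sin \<alpha>, cos \<alpha>]]"
  \<comment> \<open>The rotation \<open>A\<close> has first column u, and \<open>v\<close> is m
    times the unit vector orthogonal to u, so det(u, v) = m. The conjugate then has direction (X, -m
    u), and multiplying by \<open>cos \<theta>\<close> must produce \<open>sin \<theta>\<close> in
    the second part.\<close>
  define m where "m = - (sin \<theta> / cos \<theta>)"
  define v :: "real^2" where "v = m *\<^sub>R vector [- sin \<alpha>, cos \<alpha>]"
  have A: "det A = 1" "column 1 A = circ \<alpha>"
    by (auto simp: A_def circ_def matrix_2_simps simp flip: power2_eq_square)
  have "A$1$1 * v$2 - A$2$1 * v$1 = m * ((sin \<alpha>)\<^sup>2 + (cos \<alpha>)\<^sup>2)"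
    unfolding power2_eq_square
    by (simp add: A_def v_def algebra_simps
        del: sin_cos_squared_add sin_cos_squared_add2 sin_cos_squared_add3)
  then have "direction (\<alpha>, \<theta>) = cos \<theta> *\<^sub>R (nilp (column 1 A), (- (A$1$1 * v$2 - A$2$1 * v$1)) *\<^sub>R column 1 A)"
    using \<theta> by (simp add: A direction_def m_def)
  then have "H = conjugate_of SL2_R2 (A, v) N_plus"
    by (simp only: H conjugate_N_plus[OF A(1)] line_scaleR[OF \<theta>])
  then show "H \<in> {conjugate_of SL2_R2 g N_plus | g. g \<in> carrier SL2_R2}"
    using A carrier_SL2_R2 by blast
qed

lemma conjugates_V_0:
  "{conjugate_of SL2_R2 g V_0 | g. g \<in> carrier SL2_R2} =
   (\<lambda>p. line (direction p)) ` {p. cos (snd p) = 0}"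
proof (intro equalityI subsetI)
  fix H assume "H \<in> {conjugate_of SL2_R2 g V_0 | g. g \<in> carrier SL2_R2}"
  then obtain A v where A: "det A = 1" and H: "H = conjugate_of SL2_R2 (A, v) V_0"
    by (auto simp: carrier_SL2_R2)
  have "column 1 A \<noteq> 0" using A by (auto simp: matrix_2_simps)
  then obtain r \<alpha> where r: "r \<noteq> 0" "column 1 A = r *\<^sub>R circ \<alpha>" by (rule polar)
  have "(0, column 1 A) = r *\<^sub>R direction (\<alpha>, pi / 2)"
    unfolding r(2) direction_def by simp
  then have "H = line (direction (\<alpha>, pi / 2))"
    using r(1) by (simp only: H conjugate_V_0[OF A]) (simp add: line_scaleR)
  then show "H \<in> (\<lambda>p. line (direction p)) ` {p. cos (snd p) = 0}" by auto
next
  fix H assume "H \<in> (\<lambda>p. line (direction p)) ` {p. cos (snd p) = 0}"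
  then obtain \<alpha> \<theta> where H: "H = line (direction (\<alpha>, \<theta>))" and \<theta>: "cos \<theta> = 0" by auto
  have s: "sin \<theta> \<noteq> 0" using \<theta> sin_zero_abs_cos_one by fastforce
  define A :: "real^2^2" where "A = vector [vector [cos \<alpha>, - sin \<alpha>], vector [sin \<alpha>, cos \<alpha>]]"
  have A: "det A = 1" "column 1 A = circ \<alpha>"
    by (auto simp: A_def circ_def matrix_2_simps simp flip: power2_eq_square)
  have "direction (\<alpha>, \<theta>) = sin \<theta> *\<^sub>R (0, column 1 A)"
    using \<theta> by (simp add: A direction_def)
  then have "H = conjugate_of SL2_R2 (A, 0) V_0"
    by (simp only: H conjugate_V_0[OF A(1)] line_scaleR[OF s])
  then show "H \<in> {conjugate_of SL2_R2 g V_0 | g. g \<in> carrier SL2_R2}"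
    using A carrier_SL2_R2 by blast
qed

lemma closure_cos_nonzero: "closure {p :: real \<times> real. cos (snd p) \<noteq> 0} = UNIV"
proof -
  have "\<exists>q\<in>{p :: real \<times> real. cos (snd p) \<noteq> 0}. dist q (\<alpha>, \<theta>) < e" if "e > 0" for \<alpha> \<theta> e :: real
  proof (cases "cos \<theta> = 0")
    case True
    \<comment> \<open>The bound 1 keeps \<open>h\<close> below pi, so \<open>sin h\<close> is
      positive; at a zero of the cosine, cos(\<theta> + h) = - sin \<theta> sin h.\<close>
    define h where "h = min (e / 2) 1"
    have h: "0 < h" "h < e" "h \<le> 1" using that by (auto simp: h_def)
    then have "sin h \<noteq> 0" using sin_gt_zero[of h] pi_gt3 by auto
    moreover have "sin \<theta> \<noteq> 0" using True sin_zero_abs_cos_one by fastforce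
    ultimately have "cos (\<theta> + h) \<noteq> 0" using True by (simp add: cos_add)
    moreover have "dist (\<alpha>, \<theta> + h) (\<alpha>, \<theta>) < e"
      using h by (simp add: dist_Pair_Pair dist_real_def)
    ultimately show ?thesis by force
  next
    case False
    with that show ?thesis by (intro bexI[of _ "(\<alpha>, \<theta>)"]) auto
  qed
  then show ?thesis by (auto simp: closure_approachable)
qed

text \<open>Periodicity in both angles replaces the plane by a compact square, which makes the
  family of lines compact.\<close>

lemma range_direction:
  "range (\<lambda>p. line (direction p)) = (\<lambda>p. line (direction p)) ` ({0..2*pi} \<times> {0..2*pi})"
proof -
  have "\<exists>y\<in>{0..2*pi}. cos x = cos y \<and> sin x = sin y" for x :: real
    using sincos_total_2pi_le[of "cos x" "sin x"] by fastforce
  then have *: "\<exists>q\<in>{0..2*pi} \<times> {0..2*pi}. direction p = direction q" for p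
    unfolding direction_def circ_def by (metis SigmaI fst_conv snd_conv)
  show ?thesis
  proof (intro equalityI subsetI)
    fix H assume "H \<in> range (\<lambda>p. line (direction p))"
    then obtain p where "H = line (direction p)" by auto
    with * show "H \<in> (\<lambda>p. line (direction p)) ` ({0..2*pi} \<times> {0..2*pi})"
      by (metis image_eqI)
  qed auto
qed

lemma closed_carrier_SL2_R2: "closed (carrier SL2_R2)"
proof -
  have "closed {g :: real^2^2. det g = 1}"
    unfolding det_2 by (intro closed_Collect_eq continuous_intros)
  then show ?thesis by (simp add: SL2_R2_def closed_Times)
qed

theorem theorem5:
  shows "chabauty_topology SL2_R2 SL2_R2_top closure_of
           {conjugate_of SL2_R2 g N_plus | g. g \<in> carrier SL2_R2} =
         {conjugate_of SL2_R2 g N_plus | g. g \<in> carrier SL2_R2} \<union>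
         {conjugate_of SL2_R2 g V_0 | g. g \<in> carrier SL2_R2}"
proof -
  let ?X = "chabauty_topology SL2_R2 SL2_R2_top"
  let ?L = "\<lambda>p. line (direction p)"
  let ?D = "{p :: real \<times> real. cos (snd p) \<noteq> 0}"
  have cont: "continuous_map euclidean ?X ?L"
    using line_closed_subgroup continuous_direction norm_direction
    unfolding line_def SL2_R2_top_def
    by (intro continuous_map_chabauty_affine_line) (auto simp: direction_def)
  have "locally_compact_space (euclidean :: ((real^2^2) \<times> (real^2)) topology)"
    unfolding locally_compact_space_def
  proof clarsimp
    fix a :: "real^2^2" and b :: "real^2"
    show "\<exists>U. open U \<and> (\<exists>K. compact K \<and> (a, b) \<in> U \<and> U \<subseteq> K)"
      by (rule exI[of _ "ball (a, b) 1"]) (auto intro!: exI[of _ "cball (a, b) 1"])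
  qed
  then have "Hausdorff_space ?X"
    using closed_carrier_SL2_R2 unfolding SL2_R2_top_def
    by (intro Hausdorff_space_chabauty locally_compact_space_closed_subset
        Hausdorff_space_subtopology) auto
  moreover have "compactin ?X (range ?L)"
    unfolding range_direction
    by (rule image_compactin[OF _ cont]) (simp add: compact_Times)
  ultimately have "closedin ?X (range ?L)" by (simp add: compactin_imp_closedin)
  then have "?X closure_of ?L ` ?D \<subseteq> range ?L"
    by (intro closure_of_minimal) auto
  \<comment> \<open>Continuity sends the closure of \<open>?D\<close>, which is the whole plane,
    into the closure of its image.\<close>
  moreover have "range ?L \<subseteq> ?X closure_of ?L ` ?D"
    using continuous_map_image_closure_subset[OF cont, of ?D] by (simp add: closure_cos_nonzero)
  moreover have "range ?L = ?L ` ?D \<union> ?L ` {p. cos (snd p) = 0}" by auto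
  ultimately show ?thesis unfolding conjugates_N_plus conjugates_V_0 by blast
qed

end
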